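(* Let $Alt_n$ be the alternating group on $n$ elements, $n\ge 3$. 1. Let $\ell\ge 1$ be an integer and $n=2\ell+1$. Then the sequence $$t_{3},\ u_{4},\ v_{4},\ \ldots,\ t_{2\ell-1},\ u_{2\ell},\ v_{2\ell},\ t_{2\ell+1}$$ is an OGS for $Alt_n$, such that every element $g\in Alt_n$ has a unique presentation of the form $$g=t_{3}^{i_{3}}\cdot \prod_{r=2}^{\ell}u_{2r}^{j_{2r}}\cdot v_{2r}^{k_{2r}}\cdot t_{2r+1}^{i_{2r+1}},$$ with integers $0\le i_3<3$ and, for $2\le r\le \ell$, $0\le i_{2r+1}<2r+1$, $0\le j_{2r}<2$, $0\le k_{2r}<r$. (For $\ell=1$ the sequence is just $t_3$ and the product is empty.) 2. Let $\ell\ge 2$ be an integer and $n=2\ell$. Then the sequence $$t_{3},\ u_{4},\ v_{4},\ \ldots,\ t_{2\ell-1},\ u_{2\ell},\ v_{2\ell}$$ is an OGS for $Alt_n$, such that every element $g\in Alt_n$ has a unique presentation of the form $$g=\prod_{r=2}^{\ell}t_{2r-1}^{i_{2r-1}}\cdot u_{2r}^{j_{2r}}\cdot v_{2r}^{k_{2r}},$$ with integers $0\le i_{2r-1}<2r-1$, $0\le j_{2r}<2$, $0\le k_{2r}<r$ for $2\le r\le \ell$.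
   Context: $S_n$ is the symmetric group on $\{1,\ldots,n\}$ and $Alt_n\le S_n$ is the subgroup of even permutations. Permutations are multiplied left to right: $(\pi_1\cdot\pi_2)(i)=\pi_2(\pi_1(i))$. The cycle $(i_1,i_2,\ldots,i_m)$ sends $i_k\mapsto i_{k+1}$ for $1\le k\le m-1$ and $i_m\mapsto i_1$. Let $s_i=(i,i+1)$. For $2\le m\le n$, $t_m=s_1\cdot s_2\cdots s_{m-1}$, i.e. the $m$-cycle $(m,m-1,\ldots,1)$. For every integer $r$ with $2\le r\le n/2$, $$u_{2r}=t_{2r-2}\cdot s_{2r-1}=(2r-2,2r-3,\ldots,1)(2r-1,2r),\qquad v_{2r}=t_{2r}^2=(2r,2r-2,\ldots,2)(2r-1,2r-3,\ldots,1).$$ Products $\prod_{r=a}^{b}$ are ordered: the whole expression following the product sign is the factor indexed by $r$, and factors are multiplied from left to right in increasing order of $r$. An ordered sequence $\langle g_1,\ldots,g_N\rangle$ of elements of a finite group $G$ is an OGS (Ordered Generating System) of $G$ if there are positive integers $r_1,\ldots,r_N$, with $r_k$ dividing the order $|g_k|$ for each $k$, such that every $g\in G$ has a unique presentation $g=g_1^{i_1}\cdot g_2^{i_2}\cdots g_N^{i_N}$ with integers $0\le i_k<r_k$. *)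

theory Defs
  imports "HOL-Algebra.Sym_Groups" "HOL-Algebra.Multiplicative_Group"
begin

(* Left-to-right composition; the multiplication of alt_group in HOL-Algebra is
   function composition, i.e. the opposite convention. *)
definition lr_mult :: "(nat \<Rightarrow> nat) \<Rightarrow> (nat \<Rightarrow> nat) \<Rightarrow> (nat \<Rightarrow> nat)" where
  "lr_mult p q = q \<circ> p"

definition Alt :: "nat \<Rightarrow> (nat \<Rightarrow> nat) monoid" where
  "Alt n = (alt_group n)\<lparr>mult := lr_mult\<rparr>"

definition s_gen :: "nat \<Rightarrow> nat \<Rightarrow> nat" where
  "s_gen i = transpose i (i + 1)"

(* The product s_1 s_2 ... s_(m-1), multiplied from left to right. *)
definition t_gen :: "nat \<Rightarrow> nat \<Rightarrow> nat" where
  "t_gen m = foldr lr_mult (map s_gen [1..<m]) id"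

(* u_gen and v_gen are indexed by the subscript as written, so the elements used below
   are u_gen (2*r) and v_gen (2*r) with r \<ge> 2; other subscripts are irrelevant. *)
definition u_gen :: "nat \<Rightarrow> nat \<Rightarrow> nat" where
  "u_gen m = lr_mult (t_gen (m - 2)) (s_gen (m - 1))"

definition v_gen :: "nat \<Rightarrow> nat \<Rightarrow> nat" where
  "v_gen m = lr_mult (t_gen m) (t_gen m)"

(* x_1 \<otimes> (x_2 \<otimes> (... \<otimes> x_N)); finprod is only available for commutative groups. *)
definition ordered_prod :: "('a, 'b) monoid_scheme \<Rightarrow> 'a list \<Rightarrow> 'a" where
  "ordered_prod G xs = foldr (mult G) xs (one G)"

(* The sequence gs is an OGS of the finite group G, witnessed by the list rs of the integers
   r_1, ..., r_N. The exponents in a presentation are listed in es. *)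
definition OGS_with :: "('a, 'b) monoid_scheme \<Rightarrow> 'a list \<Rightarrow> nat list \<Rightarrow> bool" where
  "OGS_with G gs rs \<longleftrightarrow>
     group G \<and> finite (carrier G) \<and> set gs \<subseteq> carrier G \<and>
     length rs = length gs \<and>
     (\<forall>k < length gs. 0 < rs ! k \<and> rs ! k dvd group.ord G (gs ! k)) \<and>
     (\<forall>g \<in> carrier G. \<exists>!es :: nat list.
        length es = length gs \<and> (\<forall>k < length gs. es ! k < rs ! k) \<and>
        g = ordered_prod G (map (\<lambda>k. gs ! k [^]\<^bsub>G\<^esub> es ! k) [0..<length gs]))"

definition OGS :: "('a, 'b) monoid_scheme \<Rightarrow> 'a list \<Rightarrow> bool" where
  "OGS G gs \<longleftrightarrow> (\<exists>rs. OGS_with G gs rs)"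

(* t_3, u_4, v_4, t_5, ..., u_(2l), v_(2l), t_(2l+1) *)
definition odd_seq :: "nat \<Rightarrow> (nat \<Rightarrow> nat) list" where
  "odd_seq l = t_gen 3 #
     concat (map (\<lambda>r. [u_gen (2*r), v_gen (2*r), t_gen (2*r + 1)]) [2..<Suc l])"

definition odd_bounds :: "nat \<Rightarrow> nat list" where
  "odd_bounds l = 3 # concat (map (\<lambda>r. [2, r, 2*r + 1]) [2..<Suc l])"

(* t_3, u_4, v_4, t_5, ..., t_(2l-1), u_(2l), v_(2l) *)
definition even_seq :: "nat \<Rightarrow> (nat \<Rightarrow> nat) list" where
  "even_seq l =
     concat (map (\<lambda>r. [t_gen (2*r - 1), u_gen (2*r), v_gen (2*r)]) [2..<Suc l])"

definition even_bounds :: "nat \<Rightarrow> nat list" where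
  "even_bounds l = concat (map (\<lambda>r. [2*r - 1, 2, r]) [2..<Suc l])"

end

theory Submission
  imports Defs
begin

text \<open>
  A product of a permutation fixing \<open>n\<close> with a permutation \<open>x\<close> sends \<open>n\<close> to \<open>x n\<close>. Hence an
  OGS of \<open>Alt (n - 1)\<close> extends to one of \<open>Alt n\<close> by any sequence whose bounded words reach each
  point of \<open>{1..n}\<close> from \<open>n\<close> exactly once. For odd \<open>n\<close> the single cycle \<open>t_n\<close> does so, since
  \<open>t_n^i\<close> sends \<open>n\<close> to \<open>n - i\<close>. For \<open>n = 2r\<close> the pair \<open>u_n, v_n\<close> does so, since \<open>u_n^j v_n^k\<close>
  sends \<open>n\<close> to \<open>n - (2k + j)\<close>.
\<close>

section \<open>The alternating group with left-to-right multiplication\<close>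

lemma lr_mult_assoc: "lr_mult (lr_mult p q) r = lr_mult p (lr_mult q r)"
  by (simp add: lr_mult_def o_assoc)

lemma lr_mult_id [simp]: "lr_mult id p = p" "lr_mult p id = p" "lr_mult (\<lambda>x. x) p = p"
  by (simp_all add: lr_mult_def fun_eq_iff)

lemma mult_Alt [simp]: "p \<otimes>\<^bsub>Alt n\<^esub> q = lr_mult p q"
  by (simp add: Alt_def)

lemma one_Alt [simp]: "\<one>\<^bsub>Alt n\<^esub> = id"
  by (simp add: Alt_def alt_group_one)

lemma carrier_Alt: "carrier (Alt n) = {p. p permutes {1..n} \<and> evenperm p}"
  by (auto simp: Alt_def alt_group_carrier)

lemma permutation_Alt: "p \<in> carrier (Alt n) \<Longrightarrow> permutation p"
  by (auto simp: carrier_Alt permutation_permutes)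

lemma lr_mult_in_Alt:
  assumes "p \<in> carrier (Alt n)" "q \<in> carrier (Alt n)"
  shows "lr_mult p q \<in> carrier (Alt n)"
  using assms permutation_Alt[OF assms(1)] permutation_Alt[OF assms(2)]
  by (auto simp: carrier_Alt lr_mult_def permutes_compose evenperm_comp)

lemma inv_in_Alt:
  assumes "p \<in> carrier (Alt n)"
  shows "Hilbert_Choice.inv p \<in> carrier (Alt n)"
  using assms permutation_Alt[OF assms] by (auto simp: carrier_Alt permutes_inv evenperm_inv)

lemma lr_mult_inv_left: "p \<in> carrier (Alt n) \<Longrightarrow> lr_mult (Hilbert_Choice.inv p) p = id"
  by (auto simp: carrier_Alt lr_mult_def permutes_inv_o)

lemma lr_mult_inv_right: "p \<in> carrier (Alt n) \<Longrightarrow> lr_mult p (Hilbert_Choice.inv p) = id"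
  by (auto simp: carrier_Alt lr_mult_def permutes_inv_o)

lemma id_in_Alt [simp]: "id \<in> carrier (Alt n)"
  by (simp add: carrier_Alt permutes_id)

lemma group_Alt: "group (Alt n)"
proof (rule groupI)
  fix p assume "p \<in> carrier (Alt n)"
  then show "\<exists>q\<in>carrier (Alt n). q \<otimes>\<^bsub>Alt n\<^esub> p = \<one>\<^bsub>Alt n\<^esub>"
    using inv_in_Alt[of p n] lr_mult_inv_left[of p n]
    by (intro bexI[of _ "Hilbert_Choice.inv p"]) simp_all
qed (simp_all add: lr_mult_in_Alt lr_mult_assoc)

lemma finite_Alt: "finite (carrier (Alt n))"
  by (rule finite_subset[OF _ finite_permutations[of "{1..n}"]]) (auto simp: carrier_Alt)

lemma nat_pow_Alt [simp]: "p [^]\<^bsub>Alt n\<^esub> (k::nat) = p ^^ k"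
  by (induction k) (simp_all add: nat_pow_def lr_mult_def)

lemma Alt_mono: "m \<le> n \<Longrightarrow> carrier (Alt m) \<subseteq> carrier (Alt n)"
  by (auto simp: carrier_Alt intro: permutes_subset)

lemma funpow_in_Alt: "p \<in> carrier (Alt n) \<Longrightarrow> p ^^ k \<in> carrier (Alt n)"
  by (induction k) (auto simp: lr_mult_in_Alt[unfolded lr_mult_def])

text \<open>Identifies the stabiliser of the point \<open>Suc n\<close> in
  \<open>Alt (Suc n)\<close> with \<open>Alt n\<close>; parity does not depend on the ambient
  set.\<close>

lemma Alt_Suc_fixing:
  assumes "p \<in> carrier (Alt (Suc n))" "p (Suc n) = Suc n"
  shows "p \<in> carrier (Alt n)"
proof -
  have "p permutes {1..n}"
  proof (rule permutes_superset)
    show "p permutes {1..Suc n}" using assms(1) by (simp add: carrier_Alt)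
    fix x assume "x \<in> {1..Suc n} - {1..n}"
    then have "x = Suc n" by auto
    then show "p x = x" using assms(2) by simp
  qed
  then show ?thesis using assms(1) by (simp add: carrier_Alt)
qed

lemma Alt_2: "carrier (Alt 2) = {id}"
proof -
  have "p = id" if "p permutes {1..2}" "evenperm p" for p :: "nat \<Rightarrow> nat"
  proof -
    have "{1..2} = {1, 2::nat}" by auto
    then have "p = id \<or> p = transpose 1 2"
      using that(1) permutes_doubleton_iff by metis
    then show ?thesis using that(2) by (auto simp: evenperm_swap)
  qed
  then show ?thesis by (auto simp: carrier_Alt permutes_id)
qed

section \<open>Words with bounded exponents\<close>

text \<open>Takes no group as argument, so that one and the same word can be read in
  \<open>Alt n\<close> and in \<open>Alt (Suc n)\<close>.\<close>

definition word :: "(nat \<Rightarrow> nat) list \<Rightarrow> nat list \<Rightarrow> nat \<Rightarrow> nat" where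
  "word gs es = foldr lr_mult (map2 (\<lambda>g e. g ^^ e) gs es) id"

lemma word_Nil [simp]: "word [] es = id"
  by (simp add: word_def)

lemma word_Cons [simp]: "word (g # gs) (e # es) = lr_mult (g ^^ e) (word gs es)"
  by (simp add: word_def)

lemma word_append:
  "length es = length gs \<Longrightarrow> word (gs @ hs) (es @ fs) = lr_mult (word gs es) (word hs fs)"
  by (induction es gs rule: list_induct2) (simp_all add: lr_mult_assoc)

lemma word_in_Alt:
  "length es = length gs \<Longrightarrow> set gs \<subseteq> carrier (Alt n) \<Longrightarrow> word gs es \<in> carrier (Alt n)"
  by (induction es gs rule: list_induct2) (simp_all add: lr_mult_in_Alt funpow_in_Alt)

lemma ordered_prod_eq_word:
  assumes "length es = length gs"
  shows "ordered_prod (Alt n) (map (\<lambda>k. gs ! k [^]\<^bsub>Alt n\<^esub> es ! k) [0..<length gs]) = word gs es"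
proof -
  have "map2 (\<lambda>g e. g ^^ e) gs es = map (\<lambda>k. gs ! k ^^ es ! k) [0..<length gs]"
    using assms by (intro nth_equalityI) auto
  moreover have "mult (Alt n) = lr_mult"
    by (intro ext) simp
  ultimately show ?thesis by (simp add: ordered_prod_def word_def)
qed

section \<open>Ordered generating systems of \<open>Alt n\<close> and their extension by one
  point\<close>

lemma dvd_ord_Alt:
  assumes "g \<in> carrier (Alt n)"
  shows "r dvd group.ord (Alt n) g \<longleftrightarrow> (\<forall>k. g ^^ k = id \<longrightarrow> r dvd k)"
proof -
  have "g ^^ k = id \<longleftrightarrow> group.ord (Alt n) g dvd k" for k
    using group.pow_eq_id[OF group_Alt assms, of k] by simp
  then show ?thesis by (meson dvd_refl dvd_trans)
qed

text \<open>On the right, neither the order condition nor the word depends on \<open>n\<close>, so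
  both carry over unchanged to a larger alternating group. The use of \<open>list_all2\<close> makes
  the conditions on bounds and exponents compatible with appending lists.\<close>

lemma OGS_with_Alt_iff:
  "OGS_with (Alt n) gs rs \<longleftrightarrow>
     set gs \<subseteq> carrier (Alt n) \<and>
     list_all2 (\<lambda>g r. 0 < r \<and> (\<forall>k. g ^^ k = id \<longrightarrow> r dvd k)) gs rs \<and>
     (\<forall>g\<in>carrier (Alt n). \<exists>!es. list_all2 (<) es rs \<and> g = word gs es)"
proof (cases "length gs = length rs \<and> set gs \<subseteq> carrier (Alt n)")
  case True
  have "(length es = length gs \<and> (\<forall>k<length gs. es ! k < rs ! k) \<and>
          g = ordered_prod (Alt n) (map (\<lambda>k. gs ! k [^]\<^bsub>Alt n\<^esub> es ! k) [0..<length gs]))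
      \<longleftrightarrow> list_all2 (<) es rs \<and> g = word gs es" for es g
    using True ordered_prod_eq_word[of es gs n]
    by (auto simp: list_all2_conv_all_nth simp del: nat_pow_Alt)
  moreover have "rs ! k dvd group.ord (Alt n) (gs ! k) \<longleftrightarrow>
      (\<forall>j. (gs ! k) ^^ j = id \<longrightarrow> rs ! k dvd j)" if "k < length gs" for k
    using True that by (intro dvd_ord_Alt) auto
  ultimately show ?thesis
    using True by (auto simp: OGS_with_def group_Alt finite_Alt list_all2_conv_all_nth)
next
  case False
  then show ?thesis by (auto simp: OGS_with_def dest: list_all2_lengthD)
qed

text \<open>Under left-to-right multiplication the right coset of \<open>Alt n\<close> through
  \<open>g\<close> is determined by \<open>g (Suc n)\<close>. By \<open>orbit\<close> the words in
  \<open>xs\<close> form a transversal of these cosets, so \<open>g\<close> factors uniquely as an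
  element of \<open>Alt n\<close> followed by such a word.\<close>

lemma OGS_with_Alt_append:
  assumes OGS: "OGS_with (Alt n) gs rs"
    and xs: "set xs \<subseteq> carrier (Alt (Suc n))"
    and ord: "list_all2 (\<lambda>g r. 0 < r \<and> (\<forall>k. g ^^ k = id \<longrightarrow> r dvd k)) xs ss"
    and orbit: "\<And>a. a \<in> {1..Suc n} \<Longrightarrow> \<exists>!fs. list_all2 (<) fs ss \<and> word xs fs (Suc n) = a"
  shows "OGS_with (Alt (Suc n)) (gs @ xs) (rs @ ss)"
proof -
  have gs: "set gs \<subseteq> carrier (Alt n)"
    and ordg: "list_all2 (\<lambda>g r. 0 < r \<and> (\<forall>k. g ^^ k = id \<longrightarrow> r dvd k)) gs rs"
    and ex: "\<And>g. g \<in> carrier (Alt n) \<Longrightarrow> \<exists>!es. list_all2 (<) es rs \<and> g = word gs es"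
    using OGS by (auto simp: OGS_with_Alt_iff)
  have len: "length gs = length rs" "length xs = length ss"
    using ordg ord by (auto dest: list_all2_lengthD)
  have gs': "set gs \<subseteq> carrier (Alt (Suc n))"
    using gs Alt_mono[of n "Suc n"] by auto
  have "\<exists>!es. list_all2 (<) es (rs @ ss) \<and> g = word (gs @ xs) es"
    if g: "g \<in> carrier (Alt (Suc n))" for g
  proof -
    have "g (Suc n) \<in> {1..Suc n}"
      using g permutes_in_image[of g "{1..Suc n}" "Suc n"] by (simp add: carrier_Alt)
    from orbit[OF this] obtain fs where fs: "list_all2 (<) fs ss" "word xs fs (Suc n) = g (Suc n)"
      and fs_unique: "\<And>fs'. list_all2 (<) fs' ss \<Longrightarrow> word xs fs' (Suc n) = g (Suc n) \<Longrightarrow> fs' = fs"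
      by blast
    define x where "x = word xs fs"
    have x: "x \<in> carrier (Alt (Suc n))"
      unfolding x_def using fs(1) xs len by (intro word_in_Alt) (auto dest: list_all2_lengthD)
    \<comment> \<open>What remains of \<open>g\<close> after \<open>x\<close> is cancelled on the
      right. It fixes \<open>Suc n\<close> because \<open>g\<close> and \<open>x\<close> agree
      there.\<close>
    define h where "h = lr_mult g (Hilbert_Choice.inv x)"
    have "Hilbert_Choice.inv x (x (Suc n)) = Suc n"
      using x by (auto simp: carrier_Alt permutes_inverses)
    then have "h (Suc n) = Suc n"
      using fs(2) by (simp add: h_def lr_mult_def x_def)
    moreover have "h \<in> carrier (Alt (Suc n))"
      unfolding h_def by (intro lr_mult_in_Alt inv_in_Alt g x)
    ultimately have h: "h \<in> carrier (Alt n)"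
      by (rule Alt_Suc_fixing[rotated])
    have hx: "lr_mult h x = g"
      using x by (simp add: h_def lr_mult_assoc lr_mult_inv_left)
    obtain es where es: "list_all2 (<) es rs" "h = word gs es"
      and es_unique: "\<And>es'. list_all2 (<) es' rs \<Longrightarrow> h = word gs es' \<Longrightarrow> es' = es"
      using ex[OF h] by blast
    show ?thesis
    proof (rule ex1I)
      show "list_all2 (<) (es @ fs) (rs @ ss) \<and> g = word (gs @ xs) (es @ fs)"
        using es fs len hx
        by (auto simp: word_append x_def list_all2_lengthD intro!: list_all2_appendI)
    next
      fix es'' assume *: "list_all2 (<) es'' (rs @ ss) \<and> g = word (gs @ xs) es''"
      then obtain es' fs' where es'': "es'' = es' @ fs'"
        and es': "list_all2 (<) es' rs" and fs': "list_all2 (<) fs' ss"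
        by (auto simp: list_all2_append2)
      have g_eq: "g = lr_mult (word gs es') (word xs fs')"
        using * es' len unfolding es'' by (auto simp: word_append dest: list_all2_lengthD)
      have "word gs es' \<in> carrier (Alt n)"
        using es' gs len by (intro word_in_Alt) (auto dest: list_all2_lengthD)
      \<comment> \<open>Since \<open>Suc n\<close> lies outside \<open>{1..n}\<close>, only the
        second part of the word can move it; its image under \<open>g\<close> therefore determines
        \<open>fs'\<close>.\<close>
      then have "word gs es' (Suc n) = Suc n"
        by (auto simp: carrier_Alt intro: permutes_not_in)
      then have "fs' = fs"
        using fs' g_eq by (intro fs_unique) (simp_all add: lr_mult_def)
      moreover have "h = word gs es'"
        using x \<open>fs' = fs\<close> by (simp add: h_def g_eq lr_mult_assoc lr_mult_inv_right flip: x_def)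
      then have "es' = es"
        using es' by (intro es_unique)
      ultimately show "es'' = es @ fs" by (simp add: es'')
    qed
  qed
  then show ?thesis
    using gs' xs ord ordg by (auto simp: OGS_with_Alt_iff intro: list_all2_appendI)
qed

section \<open>The generators\<close>

lemma s_gen_permutes: "1 \<le> i \<Longrightarrow> i < n \<Longrightarrow> s_gen i permutes {1..n}"
  by (auto simp: s_gen_def intro: permutes_swap_id)

lemma t_gen_1 [simp]: "t_gen (Suc 0) = id"
  by (simp add: t_gen_def)

text \<open>Lets the last factor of a product be split off, as the recursion for
  \<open>t_gen\<close> requires; the fold itself exposes only the first.\<close>

lemma foldr_lr_mult: "foldr lr_mult xs p = lr_mult (foldr lr_mult xs id) p"
  by (induction xs) (simp_all add: lr_mult_assoc)

lemma t_gen_Suc: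
  assumes "1 \<le> m"
  shows "t_gen (Suc m) = lr_mult (t_gen m) (s_gen m)"
  using assms by (simp add: t_gen_def foldr_lr_mult[of _ "s_gen m"])

text \<open>Multiplying the cycle \<open>(m, ..., 1)\<close> on the right by \<open>s_gen m\<close>
  redirects \<open>1\<close> from \<open>m\<close> to \<open>m + 1\<close> and sends the new point
  \<open>m + 1\<close> to \<open>m\<close>.\<close>

lemma t_gen_apply:
  assumes "1 \<le> m"
  shows "t_gen m i = (if i = 1 then m else if 2 \<le> i \<and> i \<le> m then i - 1 else i)"
  using assms
proof (induction m arbitrary: i rule: dec_induct)
  case (step m)
  then show ?case
    by (auto simp: t_gen_Suc lr_mult_def s_gen_def transpose_def)
qed auto

text \<open>There are \<open>m - 1\<close> transpositions in the product, so the parity flips each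
  time \<open>m\<close> grows by one.\<close>

lemma t_gen_permutes_evenperm:
  assumes "1 \<le> m"
  shows "t_gen m permutes {1..m} \<and> (evenperm (t_gen m) \<longleftrightarrow> odd m)"
  using assms
proof (induction m rule: dec_induct)
  case base
  then show ?case by (auto simp: permutes_id id_def)
next
  case (step m)
  have t: "t_gen m permutes {1..Suc m}"
    by (rule permutes_subset[OF conjunct1[OF step.IH]]) auto
  have s: "s_gen m permutes {1..Suc m}"
    using step.hyps by (intro s_gen_permutes) auto
  have "permutation (t_gen m)" "permutation (s_gen m)"
    using t s by (auto simp: permutation_permutes)
  then have "evenperm (t_gen (Suc m)) \<longleftrightarrow> evenperm (s_gen m) = evenperm (t_gen m)"
    using step.hyps by (simp add: t_gen_Suc lr_mult_def evenperm_comp)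
  moreover have "\<not> evenperm (s_gen m)"
    by (simp add: s_gen_def evenperm_swap)
  moreover have "t_gen (Suc m) permutes {1..Suc m}"
    using step.hyps permutes_compose[OF t s] by (simp add: t_gen_Suc lr_mult_def)
  ultimately show ?case using step.IH by simp
qed

lemma t_gen_in_Alt:
  assumes "odd m"
  shows "t_gen m \<in> carrier (Alt m)"
  using t_gen_permutes_evenperm[of m] assms odd_pos[OF assms] by (auto simp: carrier_Alt)

text \<open>The point descends by one at each application and jumps from \<open>1\<close> back to
  \<open>m\<close>, so \<open>k mod m\<close> counts the steps since the last return.\<close>

lemma funpow_t_gen:
  assumes "1 \<le> m"
  shows "(t_gen m ^^ k) m = m - k mod m"
proof (induction k)
  case (Suc k)
  have "k mod m < m" using assms by simp
  then show ?case
    using assms Suc by (auto simp: t_gen_apply mod_Suc)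
qed simp

lemma t_gen_order:
  assumes "1 \<le> m" "t_gen m ^^ k = id"
  shows "m dvd k"
proof -
  have "m - k mod m = m"
    using funpow_t_gen[OF assms(1), of k] assms(2) by simp
  moreover have "k mod m < m" using assms(1) by simp
  ultimately show ?thesis by (simp add: dvd_eq_mod_eq_0)
qed

lemma v_gen_funpow: "v_gen m ^^ k = t_gen m ^^ (2 * k)"
proof -
  have "v_gen m = t_gen m ^^ 2"
    by (simp add: v_gen_def lr_mult_def numeral_2_eq_2)
  then show ?thesis by (simp add: funpow_mult mult.commute)
qed

text \<open>A square is even, whatever the parity of the permutation squared.\<close>

lemma v_gen_in_Alt:
  assumes "1 \<le> m"
  shows "v_gen m \<in> carrier (Alt m)"
proof -
  have "t_gen m permutes {1..m}" using t_gen_permutes_evenperm[OF assms] by simp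
  moreover from this have "permutation (t_gen m)" by (auto simp: permutation_permutes)
  ultimately show ?thesis
    by (simp add: carrier_Alt v_gen_def lr_mult_def permutes_compose evenperm_comp)
qed

text \<open>As \<open>v_gen (2 * r)\<close> is the square of a cycle of length \<open>2 * r\<close>,
  the exponent \<open>2 * k\<close> of that cycle must be a multiple of
  \<open>2 * r\<close>.\<close>

lemma v_gen_order:
  assumes "1 \<le> r" "v_gen (2 * r) ^^ k = id"
  shows "r dvd k"
  using t_gen_order[of "2 * r" "2 * k"] assms by (simp add: v_gen_funpow)

text \<open>Both factors are odd: the first is a cycle of even length, the second a
  transposition.\<close>

lemma u_gen_in_Alt:
  assumes "2 \<le> r"
  shows "u_gen (2 * r) \<in> carrier (Alt (2 * r))"
proof -
  have t: "t_gen (2*r - 2) permutes {1..2*r - 2}" "\<not> evenperm (t_gen (2*r - 2))"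
    using t_gen_permutes_evenperm[of "2*r - 2"] assms by auto
  have t': "t_gen (2*r - 2) permutes {1..2*r}"
    by (rule permutes_subset[OF t(1)]) auto
  have s: "s_gen (2*r - 1) permutes {1..2*r}"
    using assms by (intro s_gen_permutes) auto
  have "permutation (t_gen (2*r - 2))" "permutation (s_gen (2*r - 1))"
    using t' s by (auto simp: permutation_permutes)
  moreover have "\<not> evenperm (s_gen (2*r - 1))"
    by (simp add: s_gen_def evenperm_swap)
  ultimately show ?thesis
    using t(2) t' s by (simp add: carrier_Alt u_gen_def lr_mult_def permutes_compose evenperm_comp)
qed

lemma u_gen_funpow:
  assumes "2 \<le> r"
  shows "(u_gen (2 * r) ^^ k) (2 * r) = 2 * r - k mod 2"
proof (induction k)
  case (Suc k)
  \<comment> \<open>The cycle \<open>t_gen (2*r - 2)\<close> fixes both points, so they are swapped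
    by the factor \<open>s_gen (2*r - 1)\<close> alone.\<close>
  have "u_gen (2*r) (2*r) = 2*r - 1" "u_gen (2*r) (2*r - Suc 0) = 2*r"
    using assms by (auto simp: u_gen_def lr_mult_def t_gen_apply s_gen_def transpose_def)
  then show ?case
    using Suc by (cases "even k") (auto simp: mod_Suc odd_iff_mod_2_eq_one)
qed simp

lemma u_gen_order:
  assumes "2 \<le> r" "u_gen (2 * r) ^^ k = id"
  shows "2 dvd k"
proof -
  have "2*r - k mod 2 = 2*r"
    using u_gen_funpow[OF assms(1), of k] assms(2) by simp
  then show ?thesis using assms(1) by (cases "even k") (auto simp: odd_iff_mod_2_eq_one)
qed

text \<open>Both \<open>u_gen (2*r)\<close> and \<open>t_gen (2*r)\<close> send \<open>2*r\<close>
  to \<open>2*r - 1\<close>, so for \<open>j < 2\<close> their \<open>j\<close>-th powers agree at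
  \<open>2*r\<close>. The word thus acts there as the power of the cycle with exponent
  \<open>2*k + j\<close>, which takes each value below \<open>2*r\<close> exactly once.\<close>

lemma u_v_gen_apply:
  assumes "2 \<le> r" "j < 2" "k < r"
  shows "(v_gen (2*r) ^^ k) ((u_gen (2*r) ^^ j) (2*r)) = 2*r - (2*k + j)"
proof -
  have "(u_gen (2*r) ^^ j) (2*r) = (t_gen (2*r) ^^ j) (2*r)"
    using assms by (simp add: u_gen_funpow funpow_t_gen)
  then have "(v_gen (2*r) ^^ k) ((u_gen (2*r) ^^ j) (2*r)) = (t_gen (2*r) ^^ (2*k + j)) (2*r)"
    by (simp add: v_gen_funpow funpow_add)
  moreover have "2*k + j < 2*r" using assms by linarith
  ultimately show ?thesis using assms by (simp add: funpow_t_gen)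
qed

section \<open>The two extension steps and the induction along \<open>Alt 2\<close>,
  \<open>Alt 3\<close>, \<open>Alt 4\<close>, ..\<close>

lemma OGS_with_t_gen:
  assumes "OGS_with (Alt n) gs rs" "even n" "1 \<le> n"
  shows "OGS_with (Alt (Suc n)) (gs @ [t_gen (Suc n)]) (rs @ [Suc n])"
proof (rule OGS_with_Alt_append[OF assms(1)])
  show "set [t_gen (Suc n)] \<subseteq> carrier (Alt (Suc n))"
    using t_gen_in_Alt[of "Suc n"] assms by simp
  show "list_all2 (\<lambda>g r. 0 < r \<and> (\<forall>k. g ^^ k = id \<longrightarrow> r dvd k)) [t_gen (Suc n)] [Suc n]"
    using t_gen_order[of "Suc n"] by auto
  fix a assume a: "a \<in> {1..Suc n}"
  show "\<exists>!fs. list_all2 (<) fs [Suc n] \<and> word [t_gen (Suc n)] fs (Suc n) = a"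
  proof (rule ex1I)
    \<comment> \<open>It takes \<open>Suc n - a\<close> steps down the cycle to get from
      \<open>Suc n\<close> to \<open>a\<close>; as \<open>a\<close> is at least \<open>1\<close>,
      this exponent is at most \<open>n\<close>.\<close>
    show "list_all2 (<) [Suc n - a] [Suc n] \<and> word [t_gen (Suc n)] [Suc n - a] (Suc n) = a"
      using a funpow_t_gen[of "Suc n"] by auto
  next
    fix fs assume *: "list_all2 (<) fs [Suc n] \<and> word [t_gen (Suc n)] fs (Suc n) = a"
    then obtain i where "fs = [i]" "i < Suc n" by (auto simp: list_all2_Cons2)
    then show "fs = [Suc n - a]" using * funpow_t_gen[of "Suc n"] by auto
  qed
qed

lemma OGS_with_u_v_gen:
  assumes "OGS_with (Alt (2*r - 1)) gs rs" "2 \<le> r"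
  shows "OGS_with (Alt (2*r)) (gs @ [u_gen (2*r), v_gen (2*r)]) (rs @ [2, r])"
proof -
  have r: "Suc (2*r - 1) = 2*r" using assms(2) by simp
  show ?thesis
  proof (rule OGS_with_Alt_append[OF assms(1), unfolded r])
    show "set [u_gen (2*r), v_gen (2*r)] \<subseteq> carrier (Alt (2*r))"
      using u_gen_in_Alt v_gen_in_Alt assms(2) by simp
    show "list_all2 (\<lambda>g r. 0 < r \<and> (\<forall>k. g ^^ k = id \<longrightarrow> r dvd k)) [u_gen (2*r), v_gen (2*r)] [2, r]"
      using u_gen_order[of r] v_gen_order[of r] assms(2) by auto
    fix a assume a: "a \<in> {1..2*r}"
    have apply_word: "word [u_gen (2*r), v_gen (2*r)] [j, k] (2*r) = 2*r - (2*k + j)"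
      if "j < 2" "k < r" for j k
      using u_v_gen_apply[OF assms(2) that] by (simp add: lr_mult_def)
    show "\<exists>!fs. list_all2 (<) fs [2, r] \<and> word [u_gen (2*r), v_gen (2*r)] fs (2*r) = a"
    proof (rule ex1I)
      \<comment> \<open>The distance \<open>2*r - a\<close> down the cycle is to be written as
        \<open>2*k + j\<close>. It is below \<open>2*r\<close>, which keeps the quotient below
        \<open>r\<close>.\<close>
      let ?j = "(2*r - a) mod 2" and ?k = "(2*r - a) div 2"
      have "?j < 2" "?k < r" "2*r - (2 * ?k + ?j) = a" using a by auto
      then show "list_all2 (<) [?j, ?k] [2, r] \<and> word [u_gen (2*r), v_gen (2*r)] [?j, ?k] (2*r) = a"
        using apply_word by (simp del: word_Cons)
    next
      fix fs assume *: "list_all2 (<) fs [2, r] \<and> word [u_gen (2*r), v_gen (2*r)] fs (2*r) = a"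
      then obtain j k where fs: "fs = [j, k]" "j < 2" "k < r" by (auto simp: list_all2_Cons2)
      then have "2*r - a = 2*k + j" using * apply_word a by auto
      then show "fs = [(2*r - a) mod 2, (2*r - a) div 2]" using fs by auto
    qed
  qed
qed

text \<open>A regrouping: blocks t, u, v closed by a final t, instead of blocks u, v, t after an
  initial t. For \<open>l = 1\<close> there are no blocks and the only entry is
  \<open>t_gen 3\<close>.\<close>

lemma odd_seq_eq:
  assumes "1 \<le> l"
  shows "odd_seq l = even_seq l @ [t_gen (2*l + 1)]"
    and "odd_bounds l = even_bounds l @ [2*l + 1]"
  using assms
  by (induction l rule: dec_induct)
    (auto simp: odd_seq_def even_seq_def odd_bounds_def even_bounds_def numeral_3_eq_3)

lemma OGS_with_odd_from_even:
  assumes "1 \<le> l" "OGS_with (Alt (2*l)) (even_seq l) (even_bounds l)"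
  shows "OGS_with (Alt (2*l + 1)) (odd_seq l) (odd_bounds l)"
  using OGS_with_t_gen[OF assms(2)] assms(1) by (simp add: odd_seq_eq)

text \<open>Each induction step climbs two points: \<open>t_gen (2*l + 1)\<close> leads to
  \<open>Alt (2*l + 1)\<close>, then the next pair u, v leads to
  \<open>Alt (2*l + 2)\<close>.\<close>

lemma OGS_with_even_seq:
  assumes "1 \<le> l"
  shows "OGS_with (Alt (2*l)) (even_seq l) (even_bounds l)"
  using assms
proof (induction l rule: dec_induct)
  \<comment> \<open>The group \<open>Alt 2\<close> is trivial and the sequence is empty, so the
    empty exponent list gives the only presentation.\<close>
  case base
  then show ?case
    by (simp add: even_seq_def even_bounds_def OGS_with_Alt_iff Alt_2)
next
  case (step l)
  \<comment> \<open>The last block starts with \<open>t_gen (2 * Suc l - 1)\<close>, which is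
    \<open>t_gen (2*l + 1)\<close> and completes \<open>odd_seq l\<close>.\<close>
  have "even_seq (Suc l) = odd_seq l @ [u_gen (2 * Suc l), v_gen (2 * Suc l)]"
    "even_bounds (Suc l) = odd_bounds l @ [2, Suc l]"
    using step.hyps odd_seq_eq[of l] by (simp_all add: even_seq_def even_bounds_def)
  then show ?case
    using OGS_with_u_v_gen[of "Suc l"] OGS_with_odd_from_even[OF step.hyps(1) step.IH] step.hyps
    by simp
qed

section \<open>Exponents as functions of the subscript\<close>

text \<open>Turns an exponent list back into functions of the block index, by induction on the
  number of blocks, splitting off the last three entries.\<close>

lemma ex_blocks:
  assumes "length es = 3 * n"
  shows "\<exists>f g h. es = concat (map (\<lambda>r. [f r, g r, h r]) [a..<a + n])"
  using assms
proof (induction n arbitrary: es)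
  case (Suc n)
  have "length (drop (3 * n) es) = 3" using Suc.prems by simp
  then obtain x y z where xyz: "drop (3 * n) es = [x, y, z]"
    unfolding numeral_3_eq_3 length_Suc_conv length_0_conv by blast
  have "length (take (3 * n) es) = 3 * n" using Suc.prems by simp
  then obtain f g h where
    fgh: "take (3 * n) es = concat (map (\<lambda>r. [f r, g r, h r]) [a..<a + n])"
    using Suc.IH by blast
  have "es = take (3 * n) es @ [x, y, z]"
    by (metis append_take_drop_id xyz)
  \<comment> \<open>The updates at \<open>a + n\<close> do not affect the earlier blocks, whose
    indices stay below \<open>a + n\<close>.\<close>
  also have "take (3 * n) es = concat (map (\<lambda>r. [(f(a + n := x)) r, (g(a + n := y)) r,
      (h(a + n := z)) r]) [a..<a + n])"
    unfolding fgh by (intro arg_cong[where f = concat] map_cong) auto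
  finally have "es = concat (map (\<lambda>r. [(f(a + n := x)) r, (g(a + n := y)) r,
      (h(a + n := z)) r]) [a..<a + Suc n])"
    by simp
  then show ?case by blast
qed simp

text \<open>All blocks have length three, so the two concatenations stay aligned.\<close>

lemma blocks_eq_iff:
  "concat (map (\<lambda>r. [f r, g r, h r]) rs) = concat (map (\<lambda>r. [f' r, g' r, h' r]) rs) \<longleftrightarrow>
     (\<forall>r\<in>set rs. f r = f' r \<and> g r = g' r \<and> h r = h' r)"
  by (induction rs) auto

lemma list_all2_blocks:
  "list_all2 P (concat (map (\<lambda>r. [f r, g r, h r]) rs)) (concat (map (\<lambda>r. [a r, b r, c r]) rs)) \<longleftrightarrow>
     (\<forall>r\<in>set rs. P (f r) (a r) \<and> P (g r) (b r) \<and> P (h r) (c r))"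
  by (induction rs) auto

lemma length_blocks: "length (concat (map (\<lambda>r. [f r, g r, h r]) rs)) = 3 * length rs"
  by (induction rs) auto

lemma ordered_prod_blocks:
  "ordered_prod (Alt n) (map (\<lambda>r. lr_mult (lr_mult (x r ^^ f r) (y r ^^ g r)) (z r ^^ h r)) rs) =
     word (concat (map (\<lambda>r. [x r, y r, z r]) rs)) (concat (map (\<lambda>r. [f r, g r, h r]) rs))"
  by (induction rs) (simp_all add: ordered_prod_def lr_mult_assoc)

lemma OGS_with_unique_word:
  assumes "OGS_with (Alt n) gs rs" "g \<in> carrier (Alt n)"
  obtains es where "list_all2 (<) es rs" "g = word gs es"
    "\<And>es'. list_all2 (<) es' rs \<Longrightarrow> g = word gs es' \<Longrightarrow> es' = es"
  using assms by (auto simp: OGS_with_Alt_iff)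

text \<open>An extensional function is fixed by its values at the subscripts that occur, so triples
  of exponent functions correspond one to one to exponent lists, and uniqueness transfers from the
  OGS property.\<close>

lemma odd_presentation_unique:
  assumes "1 \<le> l" "g \<in> carrier (Alt (2*l + 1))"
  shows "\<exists>!(i, j, k).
         i \<in> extensional ((\<lambda>r. 2*r + 1) ` {1..l}) \<and>
         j \<in> extensional ((\<lambda>r. 2*r) ` {2..l}) \<and>
         k \<in> extensional ((\<lambda>r. 2*r) ` {2..l}) \<and>
         i 3 < (3::nat) \<and>
         (\<forall>r \<in> {2..l}. i (2*r + 1) < 2*r + 1 \<and> j (2*r) < (2::nat) \<and> k (2*r) < r) \<and>
         g = lr_mult (t_gen 3 ^^ i 3)
             (ordered_prod (Alt (2*l + 1))
               (map (\<lambda>r. lr_mult (lr_mult (u_gen (2*r) ^^ j (2*r)) (v_gen (2*r) ^^ k (2*r)))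
                         (t_gen (2*r + 1) ^^ i (2*r + 1)))
                    [2..<Suc l]))"
    (is "\<exists>!(i, j, k). ?P i j k")
proof -
  \<comment> \<open>The exponents in the order of the generators in \<open>odd_seq l\<close>;
    subscript \<open>3\<close> stands apart because its generator precedes the first block.\<close>
  define enc :: "(nat \<Rightarrow> nat) \<Rightarrow> (nat \<Rightarrow> nat) \<Rightarrow> (nat \<Rightarrow> nat) \<Rightarrow> nat list" where
    "enc i j k = i 3 # concat (map (\<lambda>r. [j (2*r), k (2*r), i (2*r + 1)]) [2..<Suc l])" for i j k
  have P: "?P i j k \<longleftrightarrow>
       i \<in> extensional ((\<lambda>r. 2*r + 1) ` {1..l}) \<and>
       j \<in> extensional ((\<lambda>r. 2*r) ` {2..l}) \<and>
       k \<in> extensional ((\<lambda>r. 2*r) ` {2..l}) \<and>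
       list_all2 (<) (enc i j k) (odd_bounds l) \<and> g = word (odd_seq l) (enc i j k)" for i j k
    unfolding ordered_prod_blocks enc_def odd_bounds_def odd_seq_def list_all2_Cons
      list_all2_blocks word_Cons
    by (auto simp del: upt_Suc)
  obtain es where es: "list_all2 (<) es (odd_bounds l)" "g = word (odd_seq l) es"
    and es_unique: "\<And>es'. list_all2 (<) es' (odd_bounds l) \<Longrightarrow> g = word (odd_seq l) es' \<Longrightarrow> es' = es"
    using OGS_with_unique_word[OF OGS_with_odd_from_even[OF assms(1) OGS_with_even_seq[OF assms(1)]]
        assms(2)] by blast
  have "length es = Suc (3 * (l - 1))"
    using list_all2_lengthD[OF es(1)] by (simp add: odd_bounds_def length_blocks del: upt_Suc)
  then obtain e es0 where "es = e # es0" "length es0 = 3 * (l - 1)"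
    by (auto simp: length_Suc_conv)
  moreover have "2 + (l - 1) = Suc l" using assms(1) by simp
  ultimately obtain f g' h where
    es_eq: "es = e # concat (map (\<lambda>r. [f r, g' r, h r]) [2..<Suc l])"
    using ex_blocks[of es0 "l - 1" 2] by auto
  \<comment> \<open>Division by 2 recovers \<open>r\<close> from the subscript
    \<open>2*r + 1\<close>. Subscript \<open>3\<close> would give \<open>r = 1\<close>, for which
    there is no block, and takes the leading entry \<open>e\<close> instead.\<close>
  define i where "i = restrict (\<lambda>m. if m = 3 then e else h (m div 2)) ((\<lambda>r. 2*r + 1) ` {1..l})"
  define j where "j = restrict (\<lambda>m. f (m div 2)) ((\<lambda>r. 2*r) ` {2..l})"
  define k where "k = restrict (\<lambda>m. g' (m div 2)) ((\<lambda>r. 2*r) ` {2..l})"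
  \<comment> \<open>Ensures that the restriction keeps the value \<open>e\<close> at
    \<open>3\<close> and does not replace it by \<open>undefined\<close>.\<close>
  have "3 \<in> (\<lambda>r. 2*r + 1) ` {1..l}" using assms(1) by (intro image_eqI[of _ _ 1]) auto
  then have enc: "enc i j k = es"
    by (auto simp: enc_def es_eq blocks_eq_iff i_def j_def k_def simp del: upt_Suc)
  show ?thesis
  proof (rule ex1I[of _ "(i, j, k)"])
    show "case (i, j, k) of (i, j, k) \<Rightarrow> ?P i j k"
      unfolding case_prod_conv P enc using es by (simp add: i_def j_def k_def)
  next
    fix x assume x: "case x of (i, j, k) \<Rightarrow> ?P i j k"
    obtain i' j' k' where x_eq: "x = (i', j', k')" by (cases x)
    have *: "i' \<in> extensional ((\<lambda>r. 2*r + 1) ` {1..l})"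
       "j' \<in> extensional ((\<lambda>r. 2*r) ` {2..l})"
       "k' \<in> extensional ((\<lambda>r. 2*r) ` {2..l})"
       "list_all2 (<) (enc i' j' k') (odd_bounds l)" "g = word (odd_seq l) (enc i' j' k')"
      using x unfolding x_eq case_prod_conv P by auto
    have "enc i' j' k' = enc i j k"
      using es_unique[OF *(4,5)] enc by simp
    then have i3: "i' 3 = i 3"
      and eq: "\<And>r. r \<in> {2..l} \<Longrightarrow> j' (2*r) = j (2*r) \<and> k' (2*r) = k (2*r) \<and> i' (2*r + 1) = i (2*r + 1)"
      unfolding enc_def list.inject blocks_eq_iff by auto
    \<comment> \<open>The case \<open>r = 1\<close> is the leading exponent; all other values are
      read off the blocks.\<close>
    have "i' (2*r + 1) = i (2*r + 1)" if "r \<in> {1..l}" for r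
      using i3 eq[of r] that by (cases "r = 1") (auto simp: numeral_3_eq_3)
    moreover have "i \<in> extensional ((\<lambda>r. 2*r + 1) ` {1..l})"
      by (simp add: i_def)
    ultimately have "i' = i"
      using *(1) by (intro extensionalityI[of _ "(\<lambda>r. 2*r + 1) ` {1..l}"]) auto
    moreover have "j' = j"
      using *(2) eq by (intro extensionalityI[of _ "(\<lambda>r. 2*r) ` {2..l}"]) (auto simp: j_def)
    moreover have "k' = k"
      using *(3) eq by (intro extensionalityI[of _ "(\<lambda>r. 2*r) ` {2..l}"]) (auto simp: k_def)
    ultimately show "x = (i, j, k)" by (simp add: x_eq)
  qed
qed

text \<open>The same correspondence as in the odd case, but the word now consists of full blocks
  only, so no exponent needs separate treatment.\<close>

lemma even_presentation_unique:
  assumes "1 \<le> l" "g \<in> carrier (Alt (2*l))"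
  shows "\<exists>!(i, j, k).
         i \<in> extensional ((\<lambda>r. 2*r - 1) ` {2..l}) \<and>
         j \<in> extensional ((\<lambda>r. 2*r) ` {2..l}) \<and>
         k \<in> extensional ((\<lambda>r. 2*r) ` {2..l}) \<and>
         (\<forall>r \<in> {2..l}. i (2*r - 1) < 2*r - 1 \<and> j (2*r) < (2::nat) \<and> k (2*r) < r) \<and>
         g = ordered_prod (Alt (2*l))
               (map (\<lambda>r. lr_mult (lr_mult (t_gen (2*r - 1) ^^ i (2*r - 1)) (u_gen (2*r) ^^ j (2*r)))
                         (v_gen (2*r) ^^ k (2*r)))
                    [2..<Suc l])"
    (is "\<exists>!(i, j, k). ?P i j k")
proof -
  define enc :: "(nat \<Rightarrow> nat) \<Rightarrow> (nat \<Rightarrow> nat) \<Rightarrow> (nat \<Rightarrow> nat) \<Rightarrow> nat list" where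
    "enc i j k = concat (map (\<lambda>r. [i (2*r - 1), j (2*r), k (2*r)]) [2..<Suc l])" for i j k
  have P: "?P i j k \<longleftrightarrow>
       i \<in> extensional ((\<lambda>r. 2*r - 1) ` {2..l}) \<and>
       j \<in> extensional ((\<lambda>r. 2*r) ` {2..l}) \<and>
       k \<in> extensional ((\<lambda>r. 2*r) ` {2..l}) \<and>
       list_all2 (<) (enc i j k) (even_bounds l) \<and> g = word (even_seq l) (enc i j k)" for i j k
    unfolding ordered_prod_blocks enc_def even_bounds_def even_seq_def list_all2_blocks
    by (auto simp del: upt_Suc)
  obtain es where es: "list_all2 (<) es (even_bounds l)" "g = word (even_seq l) es"
    and es_unique: "\<And>es'. list_all2 (<) es' (even_bounds l) \<Longrightarrow> g = word (even_seq l) es' \<Longrightarrow> es' = es"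
    using OGS_with_unique_word[OF OGS_with_even_seq[OF assms(1)] assms(2)] by blast
  have "length es = 3 * (l - 1)"
    using list_all2_lengthD[OF es(1)] by (simp add: even_bounds_def length_blocks del: upt_Suc)
  moreover have "2 + (l - 1) = Suc l" using assms(1) by simp
  ultimately obtain f g' h where
    es_eq: "es = concat (map (\<lambda>r. [f r, g' r, h r]) [2..<Suc l])"
    using ex_blocks[of es "l - 1" 2] by auto
  \<comment> \<open>Here \<open>Suc m div 2\<close> recovers \<open>r\<close> from the odd subscript
    \<open>m = 2*r - 1\<close>.\<close>
  define i where "i = restrict (\<lambda>m. f (Suc m div 2)) ((\<lambda>r. 2*r - 1) ` {2..l})"
  define j where "j = restrict (\<lambda>m. g' (m div 2)) ((\<lambda>r. 2*r) ` {2..l})"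
  define k where "k = restrict (\<lambda>m. h (m div 2)) ((\<lambda>r. 2*r) ` {2..l})"
  have enc: "enc i j k = es"
    by (auto simp: enc_def es_eq blocks_eq_iff i_def j_def k_def simp del: upt_Suc)
  show ?thesis
  proof (rule ex1I[of _ "(i, j, k)"])
    show "case (i, j, k) of (i, j, k) \<Rightarrow> ?P i j k"
      unfolding case_prod_conv P enc using es by (simp add: i_def j_def k_def)
  next
    fix x assume x: "case x of (i, j, k) \<Rightarrow> ?P i j k"
    obtain i' j' k' where x_eq: "x = (i', j', k')" by (cases x)
    have *: "i' \<in> extensional ((\<lambda>r. 2*r - 1) ` {2..l})"
       "j' \<in> extensional ((\<lambda>r. 2*r) ` {2..l})"
       "k' \<in> extensional ((\<lambda>r. 2*r) ` {2..l})"
       "list_all2 (<) (enc i' j' k') (even_bounds l)" "g = word (even_seq l) (enc i' j' k')"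
      using x unfolding x_eq case_prod_conv P by auto
    have "enc i' j' k' = enc i j k"
      using es_unique[OF *(4,5)] enc by simp
    then have eq: "\<And>r. r \<in> {2..l} \<Longrightarrow> i' (2*r - 1) = i (2*r - 1) \<and> j' (2*r) = j (2*r) \<and> k' (2*r) = k (2*r)"
      unfolding enc_def blocks_eq_iff by auto
    have "i' = i"
      using *(1) eq by (intro extensionalityI[of _ "(\<lambda>r. 2*r - 1) ` {2..l}"]) (auto simp: i_def)
    moreover have "j' = j"
      using *(2) eq by (intro extensionalityI[of _ "(\<lambda>r. 2*r) ` {2..l}"]) (auto simp: j_def)
    moreover have "k' = k"
      using *(3) eq by (intro extensionalityI[of _ "(\<lambda>r. 2*r) ` {2..l}"]) (auto simp: k_def)
    ultimately show "x = (i, j, k)" by (simp add: x_eq)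
  qed
qed

(* The exponents i_m, j_m, k_m are extensional functions of the subscript m, so that the
   uniqueness quantifier only concerns the subscripts that occur in the product. *)
theorem theorem2p6:
  fixes l :: nat
  shows
   "(1 \<le> l \<longrightarrow>
      OGS (Alt (2*l + 1)) (odd_seq l) \<and>
      OGS_with (Alt (2*l + 1)) (odd_seq l) (odd_bounds l) \<and>
      (\<forall>g \<in> carrier (Alt (2*l + 1)). \<exists>!(i, j, k).
         i \<in> extensional ((\<lambda>r. 2*r + 1) ` {1..l}) \<and>
         j \<in> extensional ((\<lambda>r. 2*r) ` {2..l}) \<and>
         k \<in> extensional ((\<lambda>r. 2*r) ` {2..l}) \<and>
         i 3 < (3::nat) \<and>
         (\<forall>r \<in> {2..l}. i (2*r + 1) < 2*r + 1 \<and> j (2*r) < (2::nat) \<and> k (2*r) < r) \<and>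
         g = (t_gen 3 [^]\<^bsub>Alt (2*l + 1)\<^esub> i 3) \<otimes>\<^bsub>Alt (2*l + 1)\<^esub>
             ordered_prod (Alt (2*l + 1))
               (map (\<lambda>r. (u_gen (2*r) [^]\<^bsub>Alt (2*l + 1)\<^esub> j (2*r)) \<otimes>\<^bsub>Alt (2*l + 1)\<^esub>
                         (v_gen (2*r) [^]\<^bsub>Alt (2*l + 1)\<^esub> k (2*r)) \<otimes>\<^bsub>Alt (2*l + 1)\<^esub>
                         (t_gen (2*r + 1) [^]\<^bsub>Alt (2*l + 1)\<^esub> i (2*r + 1)))
                    [2..<Suc l])))
    \<and>
    (2 \<le> l \<longrightarrow>
      OGS (Alt (2*l)) (even_seq l) \<and>
      OGS_with (Alt (2*l)) (even_seq l) (even_bounds l) \<and>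
      (\<forall>g \<in> carrier (Alt (2*l)). \<exists>!(i, j, k).
         i \<in> extensional ((\<lambda>r. 2*r - 1) ` {2..l}) \<and>
         j \<in> extensional ((\<lambda>r. 2*r) ` {2..l}) \<and>
         k \<in> extensional ((\<lambda>r. 2*r) ` {2..l}) \<and>
         (\<forall>r \<in> {2..l}. i (2*r - 1) < 2*r - 1 \<and> j (2*r) < (2::nat) \<and> k (2*r) < r) \<and>
         g = ordered_prod (Alt (2*l))
               (map (\<lambda>r. (t_gen (2*r - 1) [^]\<^bsub>Alt (2*l)\<^esub> i (2*r - 1)) \<otimes>\<^bsub>Alt (2*l)\<^esub>
                         (u_gen (2*r) [^]\<^bsub>Alt (2*l)\<^esub> j (2*r)) \<otimes>\<^bsub>Alt (2*l)\<^esub>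
                         (v_gen (2*r) [^]\<^bsub>Alt (2*l)\<^esub> k (2*r)))
                    [2..<Suc l])))"
  \<comment> \<open>Group products and powers become \<open>lr_mult\<close> and iterates, the form
    in which the two presentation lemmas are stated.\<close>
  unfolding mult_Alt nat_pow_Alt
proof (intro conjI impI ballI)
  assume l: "1 \<le> l"
  show odd: "OGS_with (Alt (2*l + 1)) (odd_seq l) (odd_bounds l)"
    by (intro OGS_with_odd_from_even OGS_with_even_seq l)
  then show "OGS (Alt (2*l + 1)) (odd_seq l)"
    unfolding OGS_def by (rule exI)
next
  assume l: "2 \<le> l"
  show even: "OGS_with (Alt (2*l)) (even_seq l) (even_bounds l)"
    using l by (intro OGS_with_even_seq) simp
  then show "OGS (Alt (2*l)) (even_seq l)"
    unfolding OGS_def by (rule exI)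
qed (rule odd_presentation_unique even_presentation_unique; simp)+

end
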